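(* Let $n$ be a positive integer, let $\mathbb{X}$ be a real Banach space and let $T\in\mathbb{L}(\ell_1^n,\mathbb{X})$. For $1\le i\le n$ let $e_i=(0,\dots,0,1,0,\dots,0)\in\ell_1^n$, with $1$ in the $i$-th coordinate. (i) If $\|T\|=1$, then $T$ is left symmetric in $\mathbb{L}(\ell_1^n,\mathbb{X})$ if and only if there exists $i_0\in\{1,\dots,n\}$ such that (a) $\|T(e_{i_0})\|=1$; (b) $T(e_j)=0$ for all $j\in\{1,\dots,n\}\setminus\{i_0\}$; (c) $T(e_{i_0})$ is a left symmetric point of $\mathbb{X}$. (ii) If $\|T\|=1$, then $T$ is right symmetric in $\mathbb{L}(\ell_1^n,\mathbb{X})$ if and only if for each $1\le i\le n$, $\|T(e_i)\|=1$ and $T(e_i)$ is a right symmetric point of $\mathbb{X}$. (iii) $T$ is symmetric in $\mathbb{L}(\ell_1^n,\mathbb{X})$ if and only if $T$ is the zero operator.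
   Context: $\ell_1^n$ is $\mathbb{R}^n$ with the norm $\|x\|_1=\sum_i|x_i|$. $\mathbb{L}(\mathbb{X},\mathbb{Y})$ is the Banach space of bounded linear operators from $\mathbb{X}$ to $\mathbb{Y}$ with the operator norm. For a real Banach space $\mathbb{Z}$ and $x,y\in\mathbb{Z}$, $x\perp_B y$ means $\|x+\lambda y\|\ge\|x\|$ for all $\lambda\in\mathbb{R}$. A point $x\in\mathbb{Z}$ is left symmetric if for all $y\in\mathbb{Z}$, $x\perp_B y$ implies $y\perp_B x$; right symmetric if for all $y\in\mathbb{Z}$, $y\perp_B x$ implies $x\perp_B y$; symmetric if it is both left and right symmetric.
   Formalization: In (iii), "T symmetric implies T is the zero operator" is stated only for n ≥ 2, since for n = 1 it fails (e.g. X = ℝ, T the identity); "the zero operator is symmetric" is kept for all n. *)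

theory Defs
  imports "HOL-Analysis.Analysis"
begin

text \<open>The space l1 of dimension n is a copy of the real-valued functions on a finite index type
  of cardinality n, so that it can carry a norm other than the Euclidean one of \<^typ>\<open>real ^ 'n\<close>.\<close>

typedef 'n l1 = "UNIV :: ('n \<Rightarrow> real) set"
  morphisms l1_nth l1_of
  by simp

lemma l1_eq_iff: "x = y \<longleftrightarrow> (\<forall>i. l1_nth x i = l1_nth y i)"
  by (metis ext l1_nth_inject)

lemma l1_nth_l1_of [simp]: "l1_nth (l1_of f) = f"
  by (simp add: l1_of_inverse)

instantiation l1 :: (type) real_vector
begin

definition zero_l1_def: "0 = l1_of (\<lambda>i. 0)"
definition plus_l1_def: "x + y = l1_of (\<lambda>i. l1_nth x i + l1_nth y i)"
definition minus_l1_def: "x - y = l1_of (\<lambda>i. l1_nth x i - l1_nth y i)"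
definition uminus_l1_def: "- x = l1_of (\<lambda>i. - l1_nth x i)"
definition scaleR_l1_def: "r *\<^sub>R x = l1_of (\<lambda>i. r * l1_nth x i)"

instance
  by standard (simp_all add: l1_eq_iff zero_l1_def plus_l1_def minus_l1_def uminus_l1_def
      scaleR_l1_def algebra_simps)

end

lemma l1_nth_zero [simp]: "l1_nth 0 i = 0"
  and l1_nth_add [simp]: "l1_nth (x + y) i = l1_nth x i + l1_nth y i"
  and l1_nth_diff [simp]: "l1_nth (x - y) i = l1_nth x i - l1_nth y i"
  and l1_nth_minus [simp]: "l1_nth (- x) i = - l1_nth x i"
  and l1_nth_scaleR [simp]: "l1_nth (r *\<^sub>R x) i = r * l1_nth x i"
  by (simp_all add: zero_l1_def plus_l1_def minus_l1_def uminus_l1_def scaleR_l1_def)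

instantiation l1 :: (finite) real_normed_vector
begin

definition norm_l1_def: "norm x = (\<Sum>i\<in>UNIV. \<bar>l1_nth x i\<bar>)"
definition sgn_l1_def: "sgn (x :: 'a l1) = inverse (norm x) *\<^sub>R x"
definition dist_l1_def: "dist (x :: 'a l1) y = norm (x - y)"
definition uniformity_l1_def [code del]:
  "(uniformity :: ('a l1 \<times> 'a l1) filter) = (INF e\<in>{0<..}. principal {(x, y). dist x y < e})"
definition open_l1_def [code del]:
  "open (U :: 'a l1 set) \<longleftrightarrow> (\<forall>x\<in>U. \<forall>\<^sub>F (x', y) in uniformity. x' = x \<longrightarrow> y \<in> U)"

instance
proof
  fix x y :: "'a l1" and a :: real
  show "norm x = 0 \<longleftrightarrow> x = 0"
    by (simp add: norm_l1_def sum_nonneg_eq_0_iff l1_eq_iff)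
  show "norm (x + y) \<le> norm x + norm y"
    by (simp add: norm_l1_def sum.distrib [symmetric] sum_mono abs_triangle_ineq)
  show "norm (a *\<^sub>R x) = \<bar>a\<bar> * norm x"
    by (simp add: norm_l1_def abs_mult sum_distrib_left)
qed (simp_all only: sgn_l1_def dist_l1_def uniformity_l1_def open_l1_def)

end

definition l1_unit :: "'n \<Rightarrow> 'n l1"
  where "l1_unit i = l1_of (\<lambda>j. if j = i then 1 else 0)"

definition birkhoff_orthogonal :: "'a::real_normed_vector \<Rightarrow> 'a \<Rightarrow> bool"
  where "birkhoff_orthogonal x y \<longleftrightarrow> (\<forall>t::real. norm (x + t *\<^sub>R y) \<ge> norm x)"

definition left_symmetric :: "'a::real_normed_vector \<Rightarrow> bool"
  where "left_symmetric x \<longleftrightarrow> (\<forall>y. birkhoff_orthogonal x y \<longrightarrow> birkhoff_orthogonal y x)"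

definition right_symmetric :: "'a::real_normed_vector \<Rightarrow> bool"
  where "right_symmetric x \<longleftrightarrow> (\<forall>y. birkhoff_orthogonal y x \<longrightarrow> birkhoff_orthogonal x y)"

definition symmetric_point :: "'a::real_normed_vector \<Rightarrow> bool"
  where "symmetric_point x \<longleftrightarrow> left_symmetric x \<and> right_symmetric x"

end

theory Submission
  imports Defs
begin

text \<open>An operator on the \<open>l1\<close> space is the tuple of the images of the unit vectors, with the
  maximum norm. In these coordinates:

  If a left symmetric \<open>T\<close> of norm one has a norming unit vector \<open>e\<^sub>i\<close> and \<open>T e\<^sub>j \<noteq> 0\<close> for another
  \<open>j\<close>, erase the \<open>i\<close>-th entry of \<open>T\<close>: \<open>T\<close> is orthogonal to the result, but not conversely.

  If a right symmetric \<open>T\<close> of norm one has \<open>norm (T e\<^sub>j) < 1\<close>, replace \<open>T e\<^sub>j\<close> by the unit vector in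
  the opposite direction: the result is orthogonal to \<open>T\<close>, but not conversely.

  For the sufficiency in the right symmetric case, \<open>A\<close> orthogonal to \<open>T\<close> only gives, for each sign
  of the parameter, one coordinate in which the norm does not decrease. This is enough because
  one-sided orthogonality to a right symmetric vector \<open>v\<close> can also be reversed: move
  \<open>u\<close> along \<open>v\<close> to the nearest point, which is orthogonal to \<open>v\<close> on both sides.\<close>

section \<open>Birkhoff orthogonality and one-sided estimates along lines\<close>

lemma convex_on_norm_line:
  fixes x y :: "'a::real_normed_vector"
  shows "convex_on UNIV (\<lambda>t::real. norm (x + t *\<^sub>R y))"
proof (rule convex_onI)
  fix t a b :: real
  assume "0 < t" "t < 1"
  have "x + ((1 - t) *\<^sub>R a + t *\<^sub>R b) *\<^sub>R y = (1 - t) *\<^sub>R (x + a *\<^sub>R y) + t *\<^sub>R (x + b *\<^sub>R y)"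
    by (simp add: algebra_simps)
  also have "norm \<dots> \<le> (1 - t) * norm (x + a *\<^sub>R y) + t * norm (x + b *\<^sub>R y)"
    using \<open>0 < t\<close> \<open>t < 1\<close> by (intro norm_triangle_le) simp
  finally show "norm (x + ((1 - t) *\<^sub>R a + t *\<^sub>R b) *\<^sub>R y)
      \<le> (1 - t) * norm (x + a *\<^sub>R y) + t * norm (x + b *\<^sub>R y)" .
qed simp

text \<open>Convexity of the norm on a line carries a strict decrease at \<open>t\<close> back to
  every smaller positive parameter. Thus finitely many coordinates, each decreasing at its own
  parameter, can share a single one.\<close>

lemma norm_line_less:
  fixes x y :: "'a::real_normed_vector"
  assumes "norm (x + t *\<^sub>R y) < c" "norm x \<le> c" "0 < s" "s \<le> t"
  shows "norm (x + s *\<^sub>R y) < c"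
proof -
  have "norm (x + ((1 - s / t) *\<^sub>R 0 + (s / t) *\<^sub>R t) *\<^sub>R y)
      \<le> (1 - s / t) * norm (x + 0 *\<^sub>R y) + (s / t) * norm (x + t *\<^sub>R y)"
    using assms by (intro convex_onD[OF convex_on_norm_line]) auto
  also have "\<dots> < (1 - s / t) * c + (s / t) * c"
    using assms by (intro add_le_less_mono mult_left_mono mult_strict_left_mono) auto
  finally show ?thesis
    using assms by (simp add: algebra_simps)
qed

lemma birkhoff_orthogonal_minus_right [simp]:
  "birkhoff_orthogonal x (- y) \<longleftrightarrow> birkhoff_orthogonal x y"
  unfolding birkhoff_orthogonal_def
  by (metis minus_minus scaleR_minus_left scaleR_minus_right)

lemma birkhoff_orthogonal_zero [simp]: "birkhoff_orthogonal 0 y" "birkhoff_orthogonal x 0"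
  by (simp_all add: birkhoff_orthogonal_def)

lemma birkhoff_orthogonal_scaleR_right [simp]:
  assumes "c \<noteq> 0"
  shows "birkhoff_orthogonal x (c *\<^sub>R y) \<longleftrightarrow> birkhoff_orthogonal x y"
proof -
  have "norm x \<le> norm (x + (t / c) *\<^sub>R c *\<^sub>R y) \<longleftrightarrow> norm x \<le> norm (x + t *\<^sub>R y)" for t
    using assms by simp
  then show ?thesis
    unfolding birkhoff_orthogonal_def by (metis scaleR_scaleR)
qed

lemma birkhoff_orthogonal_scaleR_left [simp]:
  assumes "c \<noteq> 0"
  shows "birkhoff_orthogonal (c *\<^sub>R x) y \<longleftrightarrow> birkhoff_orthogonal x y"
proof -
  have "norm (c *\<^sub>R x) \<le> norm (c *\<^sub>R x + t *\<^sub>R c *\<^sub>R y) \<longleftrightarrow> norm x \<le> norm (x + t *\<^sub>R y)" for t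
  proof -
    have "c *\<^sub>R x + t *\<^sub>R c *\<^sub>R y = c *\<^sub>R (x + t *\<^sub>R y)"
      by (simp add: algebra_simps)
    then show ?thesis
      using assms by simp
  qed
  then have "birkhoff_orthogonal (c *\<^sub>R x) (c *\<^sub>R y) \<longleftrightarrow> birkhoff_orthogonal x y"
    by (simp add: birkhoff_orthogonal_def)
  then show ?thesis
    using assms by simp
qed

text \<open>Negative parameters are traded for positive ones along \<open>- y\<close>. The
  coordinate arguments below work on one side at a time, so this is how their two halves are
  joined.\<close>

lemma birkhoff_orthogonalI_pos:
  fixes x y :: "'a::real_normed_vector"
  assumes "\<And>t. t > 0 \<Longrightarrow> norm (x + t *\<^sub>R y) \<ge> norm x"
    and "\<And>t. t > 0 \<Longrightarrow> norm (x + t *\<^sub>R (- y)) \<ge> norm x"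
  shows "birkhoff_orthogonal x y"
  unfolding birkhoff_orthogonal_def
proof
  fix t :: real
  show "norm x \<le> norm (x + t *\<^sub>R y)"
    using assms(1)[of t] assms(2)[of "- t"] by (cases t "0::real" rule: linorder_cases) auto
qed

lemma left_symmetric_scaleR:
  assumes "c \<noteq> 0" "left_symmetric x"
  shows "left_symmetric (c *\<^sub>R x)"
  using assms by (simp add: left_symmetric_def)

lemma right_symmetric_scaleR:
  assumes "c \<noteq> 0" "right_symmetric x"
  shows "right_symmetric (c *\<^sub>R x)"
  using assms by (simp add: right_symmetric_def)

lemma symmetric_point_zero: "symmetric_point 0"
  by (simp add: symmetric_point_def left_symmetric_def right_symmetric_def)

lemma right_symmetric_one_sided:
  fixes u v :: "'a::real_normed_vector"
  assumes v: "right_symmetric v"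
    and uv: "\<And>t. t > 0 \<Longrightarrow> norm (u + t *\<^sub>R v) \<ge> norm u"
    and "r > 0"
  shows "norm (v + r *\<^sub>R u) \<ge> norm v"
proof (cases "v = 0")
  case False
  \<comment> \<open>By the triangle inequality, moving \<open>u\<close> along \<open>v\<close> by a
    parameter beyond this radius gives norm at least \<open>norm u\<close>. Positive parameters are
    covered by \<open>uv\<close>, so the minimum over the compact interval \<open>{- R..0}\<close>
    is global.\<close>
  define R where "R = 2 * norm u / norm v"
  have "R \<ge> 0"
    by (simp add: R_def)
  have "\<exists>t0\<in>{- R..0}. \<forall>t\<in>{- R..0}. norm (u + t0 *\<^sub>R v) \<le> norm (u + t *\<^sub>R v)"
    using \<open>R \<ge> 0\<close> by (intro continuous_attains_inf continuous_intros) auto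
  then obtain t0 where t0: "t0 \<le> 0" "- R \<le> t0"
    and min: "\<And>t. - R \<le> t \<Longrightarrow> t \<le> 0 \<Longrightarrow> norm (u + t0 *\<^sub>R v) \<le> norm (u + t *\<^sub>R v)"
    by auto
  have t0_le: "norm (u + t0 *\<^sub>R v) \<le> norm u"
    using min[of 0] \<open>R \<ge> 0\<close> by simp
  have glob: "norm (u + t0 *\<^sub>R v) \<le> norm (u + t *\<^sub>R v)" for t
  proof -
    consider "t > 0" | "- R \<le> t" "t \<le> 0" | "t < - R"
      by linarith
    then show ?thesis
    proof cases
      case 1
      then show ?thesis using uv[of t] t0_le by simp
    next
      case 2
      then show ?thesis by (rule min)
    next
      case 3
      then have "2 * norm u \<le> - t * norm v"
        using False by (simp add: R_def field_simps)
      also have "\<dots> \<le> \<bar>t\<bar> * norm v"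
        by (intro mult_right_mono) auto
      also have "\<dots> \<le> norm (u + t *\<^sub>R v) + norm u"
        using norm_triangle_ineq4[of "u + t *\<^sub>R v" u] by simp
      finally show ?thesis using t0_le by simp
    qed
  qed
  have "birkhoff_orthogonal (u + t0 *\<^sub>R v) v"
    unfolding birkhoff_orthogonal_def
    using glob by (metis add.assoc scaleR_add_left)
  then have "birkhoff_orthogonal v (u + t0 *\<^sub>R v)"
    using v by (simp add: right_symmetric_def)
  then have *: "norm v \<le> norm (v + s *\<^sub>R (u + t0 *\<^sub>R v))" for s
    by (simp add: birkhoff_orthogonal_def)
  \<comment> \<open>The factor that writes \<open>v + r u\<close> as a multiple of \<open>v\<close>
    plus a multiple of \<open>u + t0 v\<close>. The sign of \<open>t0\<close> enters here:
    \<open>t0 \<le> 0\<close> makes \<open>d \<ge> 1\<close>, so rescaling does not lower the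
    norm.\<close>
  define d where "d = 1 - r * t0"
  have d: "d \<ge> 1"
    using \<open>r > 0\<close> t0 by (simp add: d_def mult_nonneg_nonpos)
  have "d *\<^sub>R (v + (r / d) *\<^sub>R (u + t0 *\<^sub>R v)) = d *\<^sub>R v + r *\<^sub>R (u + t0 *\<^sub>R v)"
    using d by (simp add: scaleR_add_right)
  also have "\<dots> = v + r *\<^sub>R u"
    by (simp add: d_def algebra_simps)
  finally have "norm (v + r *\<^sub>R u) = d * norm (v + (r / d) *\<^sub>R (u + t0 *\<^sub>R v))"
    using d by (metis abs_of_nonneg norm_scaleR order_trans zero_le_one)
  also have "\<dots> \<ge> 1 * norm v"
    using d * by (intro mult_mono) auto
  finally show ?thesis by simp
qed simp

section \<open>Operators on l1 as tuples with the maximum norm\<close>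

text \<open>Builds the test operators from prescribed images of the unit vectors.
  \<open>Blinfun\<close> is meaningful here because the map is bounded, which is established in the
  proof of \<open>l1_map_unit\<close>.\<close>

definition l1_map :: "('n::finite \<Rightarrow> 'x::real_normed_vector) \<Rightarrow> 'n l1 \<Rightarrow>\<^sub>L 'x"
  where "l1_map f = Blinfun (\<lambda>x. \<Sum>i\<in>UNIV. l1_nth x i *\<^sub>R f i)"

lemma l1_expand:
  fixes x :: "'n::finite l1"
  shows "x = (\<Sum>i\<in>UNIV. l1_nth x i *\<^sub>R l1_unit i)"
proof -
  have nth_sum: "l1_nth (sum g A) j = (\<Sum>i\<in>A. l1_nth (g i) j)"
    for g :: "'n \<Rightarrow> 'n l1" and A j
    by (induction A rule: infinite_finite_induct) auto
  show ?thesis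
    by (simp add: l1_eq_iff nth_sum l1_unit_def if_distrib cong: if_cong)
qed

lemma l1_map_unit [simp]:
  fixes f :: "'n::finite \<Rightarrow> 'x::real_normed_vector"
  shows "blinfun_apply (l1_map f) (l1_unit i) = f i"
proof -
  have "bounded_linear (\<lambda>x. \<Sum>i\<in>UNIV. l1_nth x i *\<^sub>R f i)"
  proof (rule bounded_linear_intro)
    fix x :: "'n l1"
    have "norm (\<Sum>i\<in>UNIV. l1_nth x i *\<^sub>R f i) \<le> (\<Sum>i\<in>UNIV. \<bar>l1_nth x i\<bar> * (\<Sum>i\<in>UNIV. norm (f i)))"
      by (intro order_trans[OF norm_sum] sum_mono)
         (auto intro!: mult_left_mono member_le_sum)
    then show "norm (\<Sum>i\<in>UNIV. l1_nth x i *\<^sub>R f i) \<le> norm x * (\<Sum>i\<in>UNIV. norm (f i))"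
      by (simp add: norm_l1_def sum_distrib_right)
  qed (simp_all add: scaleR_add_left sum.distrib scaleR_sum_right)
  then show ?thesis
    by (simp add: l1_map_def bounded_linear_Blinfun_apply l1_unit_def if_distrib[of "\<lambda>c. c *\<^sub>R _"]
        cong: if_cong)
qed

lemma norm_l1_unit [simp]: "norm (l1_unit i) = 1"
  by (simp add: norm_l1_def l1_unit_def if_distrib cong: if_cong)

lemma norm_blinfun_l1_unit_le:
  fixes T :: "'n::finite l1 \<Rightarrow>\<^sub>L 'x::real_normed_vector"
  shows "norm (blinfun_apply T (l1_unit i)) \<le> norm T"
  using norm_blinfun[of T "l1_unit i"] by simp

text \<open>Expanding \<open>x\<close> in unit vectors and applying the triangle inequality bounds
  the image by \<open>c\<close> times the sum of the absolute coordinates, which is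
  \<open>c * norm x\<close>.\<close>

lemma norm_blinfun_l1_le_iff:
  fixes T :: "'n::finite l1 \<Rightarrow>\<^sub>L 'x::real_normed_vector"
  shows "norm T \<le> c \<longleftrightarrow> (\<forall>i. norm (blinfun_apply T (l1_unit i)) \<le> c)"
proof
  assume *: "\<forall>i. norm (blinfun_apply T (l1_unit i)) \<le> c"
  then have "c \<ge> 0"
    using norm_ge_zero order_trans by blast
  then show "norm T \<le> c"
  proof (rule norm_blinfun_bound)
    fix x :: "'n l1"
    have "blinfun_apply T x = (\<Sum>i\<in>UNIV. l1_nth x i *\<^sub>R blinfun_apply T (l1_unit i))"
      by (subst l1_expand[of x]) (simp add: blinfun.sum_right blinfun.scaleR_right)
    also have "norm \<dots> \<le> (\<Sum>i\<in>UNIV. \<bar>l1_nth x i\<bar> * c)"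
      using * by (intro order_trans[OF norm_sum] sum_mono) (auto intro!: mult_left_mono)
    finally show "norm (blinfun_apply T x) \<le> c * norm x"
      by (simp add: norm_l1_def sum_distrib_left mult.commute)
  qed
qed (use norm_blinfun_l1_unit_le order_trans in blast)

lemma norm_blinfun_l1_attained:
  fixes T :: "'n::finite l1 \<Rightarrow>\<^sub>L 'x::real_normed_vector"
  obtains i where "norm (blinfun_apply T (l1_unit i)) = norm T"
proof -
  let ?N = "range (\<lambda>i. norm (blinfun_apply T (l1_unit i)))"
  have "norm T \<le> Max ?N"
    by (simp add: norm_blinfun_l1_le_iff)
  moreover have "Max ?N \<in> ?N"
    by (intro Max_in) auto
  ultimately show ?thesis
    using that norm_blinfun_l1_unit_le[of T] by (metis (no_types, lifting) antisym imageE)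
qed

lemma norm_blinfun_l1_less_iff:
  fixes T :: "'n::finite l1 \<Rightarrow>\<^sub>L 'x::real_normed_vector"
  shows "norm T < c \<longleftrightarrow> (\<forall>i. norm (blinfun_apply T (l1_unit i)) < c)"
  by (metis norm_blinfun_l1_attained norm_blinfun_l1_unit_le order_le_less_trans)

lemma norm_blinfun_l1_ge_iff:
  fixes T :: "'n::finite l1 \<Rightarrow>\<^sub>L 'x::real_normed_vector"
  shows "c \<le> norm T \<longleftrightarrow> (\<exists>i. c \<le> norm (blinfun_apply T (l1_unit i)))"
  using norm_blinfun_l1_less_iff[of T c] by (auto simp: not_less[symmetric])

lemmas blinfun_line = blinfun.add_left blinfun.diff_left blinfun.scaleR_left

text \<open>The point is that one index serves all positive \<open>t\<close>. If every coordinate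
  dropped below \<open>norm A\<close> at some parameter, all of them would do so at the smallest of
  these finitely many parameters, and so would the operator norm.\<close>

lemma norm_l1_line_attained:
  fixes A T :: "'n::finite l1 \<Rightarrow>\<^sub>L 'x::real_normed_vector"
  assumes "\<And>t. t > 0 \<Longrightarrow> norm (A + t *\<^sub>R T) \<ge> norm A"
  obtains i where "\<And>t. t > 0 \<Longrightarrow>
    norm (blinfun_apply A (l1_unit i) + t *\<^sub>R blinfun_apply T (l1_unit i)) \<ge> norm A"
proof (rule ccontr)
  assume "\<not> thesis"
  then have "\<forall>i. \<exists>t>0. norm (blinfun_apply A (l1_unit i) + t *\<^sub>R blinfun_apply T (l1_unit i)) < norm A"
    using that by (meson not_le)
  then obtain t where t: "\<And>i. t i > 0"
    "\<And>i. norm (blinfun_apply A (l1_unit i) + t i *\<^sub>R blinfun_apply T (l1_unit i)) < norm A"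
    by metis
  define s where "s = Min (range t)"
  have s: "s > 0" "\<And>i. s \<le> t i"
    using t(1) by (simp_all add: s_def)
  have "norm (A + s *\<^sub>R T) < norm A"
    using norm_line_less[OF t(2) norm_blinfun_l1_unit_le s]
    by (simp add: norm_blinfun_l1_less_iff[of "A + s *\<^sub>R T"] blinfun_line)
  with assms[OF s(1)] show False by simp
qed

section \<open>Left symmetric operators\<close>

lemma left_symmetric_l1_vanishes:
  fixes T :: "'n::finite l1 \<Rightarrow>\<^sub>L 'x::real_normed_vector"
  assumes T: "norm T = 1" "left_symmetric T"
    and i: "norm (blinfun_apply T (l1_unit i)) = 1" and "j \<noteq> i"
  shows "blinfun_apply T (l1_unit j) = 0"
proof (rule ccontr)
  assume nz: "blinfun_apply T (l1_unit j) \<noteq> 0"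
  \<comment> \<open>Since entry \<open>i\<close> of \<open>A\<close> is zero, \<open>T + t A\<close>
    keeps the norm one vector \<open>T e_i\<close> for every \<open>t\<close>; hence
    \<open>T\<close> is orthogonal to \<open>A\<close>.\<close>
  define A where "A = l1_map (\<lambda>k. if k = i then 0 else blinfun_apply T (l1_unit k))"
  define m where "m = norm A"
  have "norm (blinfun_apply A (l1_unit j)) \<le> m"
    unfolding m_def by (rule norm_blinfun_l1_unit_le)
  then have "m > 0"
    using nz \<open>j \<noteq> i\<close> by (simp add: A_def) (meson norm_le_zero_iff not_le order_trans)
  have "m \<le> 1"
    using norm_blinfun_l1_unit_le[of T] T(1) by (simp add: m_def A_def norm_blinfun_l1_le_iff)
  have "birkhoff_orthogonal T A"
    unfolding birkhoff_orthogonal_def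
  proof
    fix t
    show "norm T \<le> norm (T + t *\<^sub>R A)"
      using norm_blinfun_l1_unit_le[of "T + t *\<^sub>R A" i] i T(1)
      by (simp add: blinfun_line A_def)
  qed
  \<comment> \<open>The parameter \<open>- m / 2\<close> refutes the converse: entry
    \<open>i\<close> becomes a vector of norm \<open>m / 2\<close>, and all others are scaled by
    \<open>1 - m / 2\<close>, which lies in (0,1) because \<open>0 < m \<le> 1\<close>.\<close>
  then have "m \<le> norm (A + (- m / 2) *\<^sub>R T)"
    using T(2) unfolding left_symmetric_def birkhoff_orthogonal_def m_def by blast
  moreover have "norm (A + (- m / 2) *\<^sub>R T) < m"
    unfolding norm_blinfun_l1_less_iff[of "A + (- m / 2) *\<^sub>R T"]
  proof
    fix k
    show "norm (blinfun_apply (A + (- m / 2) *\<^sub>R T) (l1_unit k)) < m"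
    proof (cases "k = i")
      case True
      then show ?thesis
        using i \<open>m > 0\<close> by (simp add: blinfun_line A_def)
    next
      case False
      have "norm (blinfun_apply A (l1_unit k)) \<le> m"
        unfolding m_def by (rule norm_blinfun_l1_unit_le)
      then have "norm (blinfun_apply T (l1_unit k)) \<le> m"
        using False by (simp add: A_def)
      then have "(1 - m / 2) * norm (blinfun_apply T (l1_unit k)) \<le> (1 - m / 2) * m"
        using \<open>m \<le> 1\<close> by (intro mult_left_mono) auto
      also have "\<dots> < 1 * m"
        using \<open>m > 0\<close> by (intro mult_strict_right_mono) auto
      finally have "(1 - m / 2) * norm (blinfun_apply T (l1_unit k)) < m"
        by simp
      moreover have "blinfun_apply (A + (- m / 2) *\<^sub>R T) (l1_unit k)
          = (1 - m / 2) *\<^sub>R blinfun_apply T (l1_unit k)"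
        using False by (simp add: blinfun_line A_def scaleR_diff_left)
      ultimately show ?thesis
        using \<open>m \<le> 1\<close> by simp
    qed
  qed
  ultimately show False by simp
qed

text \<open>Operators supported on the single coordinate \<open>i\<close> form an isometric copy of
  the target space, so orthogonality there is orthogonality of the \<open>i\<close>-th
  entries.\<close>

lemma left_symmetric_l1_coordinate:
  fixes T :: "'n::finite l1 \<Rightarrow>\<^sub>L 'x::real_normed_vector"
  assumes T: "left_symmetric T"
    and zero: "\<And>j. j \<noteq> i \<Longrightarrow> blinfun_apply T (l1_unit j) = 0"
  shows "left_symmetric (blinfun_apply T (l1_unit i))"
  unfolding left_symmetric_def
proof (intro allI impI)
  fix u
  assume u: "birkhoff_orthogonal (blinfun_apply T (l1_unit i)) u"
  define A where "A = l1_map (\<lambda>k. if k = i then u else 0)"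
  have single: "norm B = norm (blinfun_apply B (l1_unit i))"
    if "\<And>j. j \<noteq> i \<Longrightarrow> blinfun_apply B (l1_unit j) = 0" for B :: "'n l1 \<Rightarrow>\<^sub>L 'x"
    using that norm_blinfun_l1_unit_le[of B i]
    by (metis antisym norm_blinfun_l1_le_iff norm_ge_zero norm_zero order_refl)
  have coord: "birkhoff_orthogonal B C \<longleftrightarrow>
      birkhoff_orthogonal (blinfun_apply B (l1_unit i)) (blinfun_apply C (l1_unit i))"
    if "\<And>j. j \<noteq> i \<Longrightarrow> blinfun_apply B (l1_unit j) = 0"
      "\<And>j. j \<noteq> i \<Longrightarrow> blinfun_apply C (l1_unit j) = 0" for B C :: "'n l1 \<Rightarrow>\<^sub>L 'x"
    using that single[of B] single[of "B + _ *\<^sub>R C"]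
    by (simp add: birkhoff_orthogonal_def blinfun_line)
  have "birkhoff_orthogonal T A"
    using u zero by (subst coord) (simp_all add: A_def)
  then have "birkhoff_orthogonal A T"
    using T by (simp add: left_symmetric_def)
  then show "birkhoff_orthogonal u (blinfun_apply T (l1_unit i))"
    using zero by (subst (asm) coord) (simp_all add: A_def)
qed

text \<open>For small parameters the entries of \<open>T + t A\<close> other than the
  \<open>i\<close>-th are too small to carry the norm, so \<open>T\<close> orthogonal to
  \<open>A\<close> passes to entry \<open>i\<close>. There it is reversed and lifted back to
  operators.\<close>

lemma left_symmetric_l1I:
  fixes T :: "'n::finite l1 \<Rightarrow>\<^sub>L 'x::real_normed_vector"
  assumes zero: "\<And>j. j \<noteq> i \<Longrightarrow> blinfun_apply T (l1_unit j) = 0"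
    and left: "left_symmetric (blinfun_apply T (l1_unit i))"
  shows "left_symmetric T"
proof (cases "T = 0")
  case True
  then show ?thesis by (simp add: left_symmetric_def)
next
  case False
  have Ti: "norm (blinfun_apply T (l1_unit i)) = norm T"
    using zero False by (metis norm_blinfun_l1_attained norm_eq_zero)
  have pos: "norm (blinfun_apply T (l1_unit i) + t *\<^sub>R blinfun_apply A (l1_unit i)) \<ge> norm T"
    if TA: "\<And>t. t > 0 \<Longrightarrow> norm (T + t *\<^sub>R A) \<ge> norm T" and "t > 0" for A :: "'n l1 \<Rightarrow>\<^sub>L 'x" and t
  proof -
    obtain k where k: "\<And>t. t > 0 \<Longrightarrow>
        norm (blinfun_apply T (l1_unit k) + t *\<^sub>R blinfun_apply A (l1_unit k)) \<ge> norm T"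
      using norm_l1_line_attained[OF TA] by blast
    have "k = i"
    proof (rule ccontr)
      assume "k \<noteq> i"
      \<comment> \<open>Small enough that \<open>s * norm A\<close> stays below
        \<open>norm T\<close>; the summand 1 guards against \<open>A = 0\<close>.\<close>
      define s where "s = norm T / (2 * (norm A + 1))"
      have "s > 0"
        using False by (simp add: s_def add_nonneg_pos)
      have "norm T \<le> s * norm (blinfun_apply A (l1_unit k))"
        using k[OF \<open>s > 0\<close>] zero[OF \<open>k \<noteq> i\<close>] \<open>s > 0\<close> by simp
      also have "\<dots> \<le> s * (norm A + 1)"
        using \<open>s > 0\<close> norm_blinfun_l1_unit_le[of A k] by (intro mult_left_mono) auto
      also have "\<dots> = norm T / 2"
        using add_nonneg_pos[OF norm_ge_zero[of A] zero_less_one] by (simp add: s_def field_simps)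
      finally show False using False by simp
    qed
    with k \<open>t > 0\<close> show ?thesis by blast
  qed
  show ?thesis
    unfolding left_symmetric_def
  proof (intro allI impI)
    fix A
    assume TA: "birkhoff_orthogonal T A"
    have "birkhoff_orthogonal (blinfun_apply T (l1_unit i)) (blinfun_apply A (l1_unit i))"
    proof (rule birkhoff_orthogonalI_pos)
      fix t :: real
      assume "t > 0"
      show "norm (blinfun_apply T (l1_unit i))
          \<le> norm (blinfun_apply T (l1_unit i) + t *\<^sub>R blinfun_apply A (l1_unit i))"
        using pos[of A t] TA \<open>t > 0\<close> Ti by (simp add: birkhoff_orthogonal_def)
      have "birkhoff_orthogonal T (- A)"
        using TA by simp
      then show "norm (blinfun_apply T (l1_unit i))
          \<le> norm (blinfun_apply T (l1_unit i) + t *\<^sub>R (- blinfun_apply A (l1_unit i)))"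
        using pos[of "- A" t] \<open>t > 0\<close> Ti
        by (simp add: birkhoff_orthogonal_def blinfun.minus_left)
    qed
    then have AT: "birkhoff_orthogonal (blinfun_apply A (l1_unit i)) (blinfun_apply T (l1_unit i))"
      using left by (simp add: left_symmetric_def)
    show "birkhoff_orthogonal A T"
      unfolding birkhoff_orthogonal_def
    proof
      fix t
      \<comment> \<open>At a norming coordinate \<open>k\<close> of \<open>A\<close>, adding
        \<open>t T\<close> cannot lower the norm: for \<open>k = i\<close> by \<open>AT\<close>,
        otherwise because \<open>T\<close> vanishes there.\<close>
      obtain k where k: "norm (blinfun_apply A (l1_unit k)) = norm A"
        by (rule norm_blinfun_l1_attained)
      have "norm (blinfun_apply A (l1_unit k)) \<le> norm (blinfun_apply (A + t *\<^sub>R T) (l1_unit k))"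
        using AT zero[of k] by (cases "k = i") (simp_all add: birkhoff_orthogonal_def blinfun_line)
      also have "\<dots> \<le> norm (A + t *\<^sub>R T)"
        by (rule norm_blinfun_l1_unit_le)
      finally show "norm A \<le> norm (A + t *\<^sub>R T)"
        using k by simp
    qed
  qed
qed

section \<open>Right symmetric operators\<close>

lemma right_symmetric_l1_norm:
  fixes T :: "'n::finite l1 \<Rightarrow>\<^sub>L 'x::real_normed_vector"
  assumes T: "norm T = 1" "right_symmetric T"
  shows "norm (blinfun_apply T (l1_unit j)) = 1"
proof (rule ccontr)
  let ?x = "\<lambda>k. blinfun_apply T (l1_unit k)"
  have le: "norm (?x k) \<le> 1" for k
    using norm_blinfun_l1_unit_le[of T k] T(1) by simp
  assume "norm (?x j) \<noteq> 1"
  with le[of j] have less: "norm (?x j) < 1" by simp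
  obtain i where i: "norm (?x i) = 1"
    using norm_blinfun_l1_attained[of T] T(1) by metis
  with less have "i \<noteq> j" by auto
  \<comment> \<open>When \<open>T e_j = 0\<close> there is no opposite direction and any unit vector
    serves; \<open>T e_i\<close> is one at hand.\<close>
  define u where "u = (if ?x j = 0 then ?x i else - sgn (?x j))"
  have u: "norm u = 1"
    using i by (simp add: u_def norm_sgn)
  have u_neg: "norm (u + t *\<^sub>R ?x j) \<ge> 1" if "t \<le> 0" for t
  proof (cases "?x j = 0")
    case True
    then show ?thesis using u by simp
  next
    case False
    have "u + t *\<^sub>R ?x j = (t - 1 / norm (?x j)) *\<^sub>R ?x j"
      using False by (simp add: u_def sgn_div_norm algebra_simps divide_inverse)
    then have "norm (u + t *\<^sub>R ?x j) = \<bar>t - 1 / norm (?x j)\<bar> * norm (?x j)"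
      by simp
    also have "\<dots> = (1 / norm (?x j) - t) * norm (?x j)"
      using that by (subst abs_of_nonpos) (auto intro: order_trans)
    also have "\<dots> = 1 - t * norm (?x j)"
      using False by (simp add: field_simps)
    also have "\<dots> \<ge> 1"
      using that by (simp add: mult_nonpos_nonneg)
    finally show ?thesis .
  qed
  \<comment> \<open>Coordinate \<open>j\<close> keeps the norm of \<open>A + t T\<close> at least 1
    for \<open>t \<le> 0\<close>, and coordinate \<open>i\<close>, where \<open>A\<close> and
    \<open>T\<close> agree, does so for \<open>t > 0\<close>.\<close>
  define A where "A = l1_map (\<lambda>k. if k = j then u else ?x k)"
  have "norm A \<le> 1"
    using le u by (simp add: A_def norm_blinfun_l1_le_iff)
  have "birkhoff_orthogonal A T"
    unfolding birkhoff_orthogonal_def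
  proof
    fix t :: real
    have "\<exists>k. 1 \<le> norm (blinfun_apply (A + t *\<^sub>R T) (l1_unit k))"
    proof (cases "t \<le> 0")
      case True
      then have "1 \<le> norm (blinfun_apply (A + t *\<^sub>R T) (l1_unit j))"
        using u_neg by (simp add: A_def blinfun_line)
      then show ?thesis ..
    next
      case False
      have "blinfun_apply (A + t *\<^sub>R T) (l1_unit i) = (1 + t) *\<^sub>R ?x i"
        using \<open>i \<noteq> j\<close> by (simp add: A_def blinfun_line scaleR_add_left)
      then have "1 \<le> norm (blinfun_apply (A + t *\<^sub>R T) (l1_unit i))"
        using False i by simp
      then show ?thesis ..
    qed
    with \<open>norm A \<le> 1\<close> show "norm A \<le> norm (A + t *\<^sub>R T)"
      by (meson norm_blinfun_l1_ge_iff order_trans)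
  qed
  then have TA: "birkhoff_orthogonal T A"
    using T(2) by (simp add: right_symmetric_def)
  \<comment> \<open>Half the gap: subtracting \<open>s A\<close> raises the norm of entry
    \<open>j\<close> by at most \<open>s\<close>, leaving it below 1, while every other entry
    shrinks by the factor \<open>1 - s\<close>.\<close>
  define s where "s = (1 - norm (?x j)) / 2"
  have s: "0 < s" "s < 1" "s + norm (?x j) < 1"
    using less by (simp_all add: s_def field_simps) (smt (verit) norm_ge_zero)
  have "norm (T + (- s) *\<^sub>R A) < 1"
    unfolding norm_blinfun_l1_less_iff[of "T + (- s) *\<^sub>R A"]
  proof
    fix k
    show "norm (blinfun_apply (T + (- s) *\<^sub>R A) (l1_unit k)) < 1"
    proof (cases "k = j")
      case True
      have "norm (?x j - s *\<^sub>R u) \<le> norm (?x j) + s"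
        using norm_triangle_ineq4[of "?x j" "s *\<^sub>R u"] u s by simp
      then show ?thesis
        using True s by (simp add: A_def blinfun_line)
    next
      case False
      then have "blinfun_apply (T + (- s) *\<^sub>R A) (l1_unit k) = (1 - s) *\<^sub>R ?x k"
        by (simp add: A_def blinfun_line scaleR_diff_left)
      then have "norm (blinfun_apply (T + (- s) *\<^sub>R A) (l1_unit k)) = (1 - s) * norm (?x k)"
        using s by simp
      also have "\<dots> \<le> (1 - s) * 1"
        using s le by (intro mult_left_mono) auto
      finally show ?thesis using s by simp
    qed
  qed
  moreover have "norm (T + (- s) *\<^sub>R A) \<ge> 1"
    using TA T(1) unfolding birkhoff_orthogonal_def by metis
  ultimately show False by simp
qed

text \<open>A vector \<open>u\<close> orthogonal to \<open>T e_j\<close> is extended to an operator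
  orthogonal to \<open>T\<close> by filling the other entries with \<open>norm u\<close> times those
  of \<open>T\<close>. Subtracting a small multiple of it from \<open>T\<close> shrinks those
  entries, so the reversed orthogonality must show in entry \<open>j\<close>. This gives one sign;
  applying it to \<open>- u\<close> gives the other.\<close>

lemma right_symmetric_l1_coordinate:
  fixes T :: "'n::finite l1 \<Rightarrow>\<^sub>L 'x::real_normed_vector"
  assumes T: "norm T = 1" "right_symmetric T"
  shows "right_symmetric (blinfun_apply T (l1_unit j))"
proof -
  let ?x = "\<lambda>k. blinfun_apply T (l1_unit k)"
  have x: "norm (?x k) = 1" for k
    by (rule right_symmetric_l1_norm[OF T])
  have neg: "norm (?x j - t *\<^sub>R u) \<ge> 1" if u: "birkhoff_orthogonal u (?x j)" and "t > 0" for u t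
  proof (cases "u = 0")
    case False
    define A where "A = l1_map (\<lambda>k. if k = j then u else norm u *\<^sub>R ?x k)"
    have "norm A \<le> norm u"
      using x by (simp add: A_def norm_blinfun_l1_le_iff)
    have "birkhoff_orthogonal A T"
      unfolding birkhoff_orthogonal_def
    proof
      fix t
      have "norm u \<le> norm (blinfun_apply (A + t *\<^sub>R T) (l1_unit j))"
        using u by (simp add: A_def blinfun_line birkhoff_orthogonal_def)
      with \<open>norm A \<le> norm u\<close> show "norm A \<le> norm (A + t *\<^sub>R T)"
        by (meson norm_blinfun_l1_ge_iff order_trans)
    qed
    then have "birkhoff_orthogonal T A"
      using T(2) by (simp add: right_symmetric_def)
    then have TA: "norm (T + (- s) *\<^sub>R A) \<ge> 1" for s
      using T(1) unfolding birkhoff_orthogonal_def by metis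
    show ?thesis
    proof (rule ccontr)
      assume "\<not> ?thesis"
      then have less: "norm (?x j + t *\<^sub>R (- u)) < 1" by simp
      \<comment> \<open>\<open>s \<le> t\<close> lets convexity transfer the decrease in entry
        \<open>j\<close>, and \<open>s * norm u \<le> 1\<close> keeps the factor
        \<open>1 - s * norm u\<close> of the other entries in [0,1).\<close>
      define s where "s = min t (1 / norm u)"
      have s: "0 < s" "s \<le> t" "s * norm u \<le> 1"
        using \<open>t > 0\<close> False by (simp_all add: s_def min_def field_simps)
      have "norm (T + (- s) *\<^sub>R A) < 1"
        unfolding norm_blinfun_l1_less_iff[of "T + (- s) *\<^sub>R A"]
      proof
        fix k
        show "norm (blinfun_apply (T + (- s) *\<^sub>R A) (l1_unit k)) < 1"
        proof (cases "k = j")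
          case True
          then show ?thesis
            using norm_line_less[OF less _ s(1,2)] x[of j] by (simp add: A_def blinfun_line)
        next
          case neq: False
          then have "blinfun_apply (T + (- s) *\<^sub>R A) (l1_unit k) = (1 - s * norm u) *\<^sub>R ?x k"
            by (simp add: A_def blinfun_line scaleR_diff_left)
          then show ?thesis
            using s False x[of k] by simp
        qed
      qed
      with TA[of s] show False by simp
    qed
  qed (simp add: x)
  show ?thesis
    unfolding right_symmetric_def
  proof (intro allI impI)
    fix u
    assume u: "birkhoff_orthogonal u (?x j)"
    then have "birkhoff_orthogonal (- u) (?x j)"
      using birkhoff_orthogonal_scaleR_left[of "-1" u] by simp
    then show "birkhoff_orthogonal (?x j) u"
      using neg[OF u] neg[of "- u"] x by (intro birkhoff_orthogonalI_pos) auto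
  qed
qed

lemma right_symmetric_l1I:
  fixes T :: "'n::finite l1 \<Rightarrow>\<^sub>L 'x::real_normed_vector"
  assumes T: "\<And>i. norm (blinfun_apply T (l1_unit i)) = norm T"
    and right: "\<And>i. right_symmetric (blinfun_apply T (l1_unit i))"
  shows "right_symmetric T"
  unfolding right_symmetric_def
proof (intro allI impI)
  have pos: "norm (T + r *\<^sub>R A) \<ge> norm T"
    if A: "birkhoff_orthogonal A T" and "r > 0" for A r
  proof -
    \<comment> \<open>The index may change with the sign of the parameter. As \<open>norm A\<close>
      dominates the norm of entry \<open>i\<close>, this entry of \<open>A\<close> is one-sidedly
      orthogonal to that of \<open>T\<close>.\<close>
    obtain i where i: "\<And>t. t > 0 \<Longrightarrow>
        norm (blinfun_apply A (l1_unit i) + t *\<^sub>R blinfun_apply T (l1_unit i)) \<ge> norm A"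
      using norm_l1_line_attained[of A T] A unfolding birkhoff_orthogonal_def by metis
    have "norm (blinfun_apply T (l1_unit i))
        \<le> norm (blinfun_apply T (l1_unit i) + r *\<^sub>R blinfun_apply A (l1_unit i))"
      using right_symmetric_one_sided[OF right _ \<open>r > 0\<close>] i norm_blinfun_l1_unit_le[of A i]
      by (meson order_trans)
    then have "norm T \<le> norm (blinfun_apply (T + r *\<^sub>R A) (l1_unit i))"
      by (simp add: T blinfun_line)
    then show ?thesis
      by (meson norm_blinfun_l1_ge_iff)
  qed
  fix A
  assume A: "birkhoff_orthogonal A T"
  then have "birkhoff_orthogonal (- A) T"
    using birkhoff_orthogonal_scaleR_left[of "-1" A] by simp
  then show "birkhoff_orthogonal T A"
    using birkhoff_orthogonalI_pos[of T A] pos A by blast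
qed

theorem theorem3p23:
  fixes T :: "'n::finite l1 \<Rightarrow>\<^sub>L 'x::banach"
  shows
    "(norm T = 1 \<longrightarrow>
        (left_symmetric T \<longleftrightarrow>
          (\<exists>i\<^sub>0. norm (blinfun_apply T (l1_unit i\<^sub>0)) = 1 \<and>
                (\<forall>j. j \<noteq> i\<^sub>0 \<longrightarrow> blinfun_apply T (l1_unit j) = 0) \<and>
                left_symmetric (blinfun_apply T (l1_unit i\<^sub>0))))) \<and>
     (norm T = 1 \<longrightarrow>
        (right_symmetric T \<longleftrightarrow>
          (\<forall>i. norm (blinfun_apply T (l1_unit i)) = 1 \<and>
               right_symmetric (blinfun_apply T (l1_unit i))))) \<and>
     (T = 0 \<longrightarrow> symmetric_point T) \<and>
     (CARD('n) \<ge> 2 \<longrightarrow> (symmetric_point T \<longleftrightarrow> T = 0))"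
proof (intro conjI impI)
  assume T: "norm T = 1"
  show "left_symmetric T \<longleftrightarrow>
      (\<exists>i\<^sub>0. norm (blinfun_apply T (l1_unit i\<^sub>0)) = 1 \<and>
        (\<forall>j. j \<noteq> i\<^sub>0 \<longrightarrow> blinfun_apply T (l1_unit j) = 0) \<and>
        left_symmetric (blinfun_apply T (l1_unit i\<^sub>0)))"
  proof
    assume left: "left_symmetric T"
    obtain i where i: "norm (blinfun_apply T (l1_unit i)) = 1"
      using norm_blinfun_l1_attained[of T] T by metis
    have zero: "blinfun_apply T (l1_unit j) = 0" if "j \<noteq> i" for j
      using left_symmetric_l1_vanishes[OF T left i that] .
    with i left_symmetric_l1_coordinate[OF left zero]
    show "\<exists>i\<^sub>0. norm (blinfun_apply T (l1_unit i\<^sub>0)) = 1 \<and>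
        (\<forall>j. j \<noteq> i\<^sub>0 \<longrightarrow> blinfun_apply T (l1_unit j) = 0) \<and>
        left_symmetric (blinfun_apply T (l1_unit i\<^sub>0))"
      by blast
  qed (use left_symmetric_l1I in blast)
  show "right_symmetric T \<longleftrightarrow>
      (\<forall>i. norm (blinfun_apply T (l1_unit i)) = 1 \<and>
        right_symmetric (blinfun_apply T (l1_unit i)))"
    using right_symmetric_l1_norm[OF T] right_symmetric_l1_coordinate[OF T] right_symmetric_l1I[of T]
    by (metis T)
next
  show "symmetric_point T" if "T = 0"
    using that by (simp add: symmetric_point_zero)
next
  \<comment> \<open>Two coordinates are essential: for n = 1 and real target, the operator space is
    one-dimensional and every operator is symmetric.\<close>
  assume card: "CARD('n) \<ge> 2"
  show "symmetric_point T \<longleftrightarrow> T = 0"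
  proof
    assume sym: "symmetric_point T"
    show "T = 0"
    proof (rule ccontr)
      assume "T \<noteq> 0"
      \<comment> \<open>Normalising preserves both symmetries. Right symmetry gives every entry norm
        one, so left symmetry, applied at a norming \<open>i\<close>, makes entry \<open>j\<close>
        zero: a contradiction.\<close>
      define S where "S = inverse (norm T) *\<^sub>R T"
      have S: "norm S = 1"
        using \<open>T \<noteq> 0\<close> by (simp add: S_def)
      have left: "left_symmetric S" and right: "right_symmetric S"
        using sym \<open>T \<noteq> 0\<close> unfolding S_def symmetric_point_def
        by (simp_all add: left_symmetric_scaleR right_symmetric_scaleR)
      obtain i j :: 'n where "j \<noteq> i"
        using card by (metis UNIV_I card_2_iff' obtain_subset_with_card_n)
      then have "blinfun_apply S (l1_unit j) = 0"
        using left_symmetric_l1_vanishes[OF S left] right_symmetric_l1_norm[OF S right] by blast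
      then show False
        using right_symmetric_l1_norm[OF S right, of j] by simp
    qed
  qed (simp add: symmetric_point_zero)
qed

end
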